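(* Let $G=(V,E)$ be a graph, let $f:2^E\to\mathbb{R}_{\ge0}$ be a non-negative submodular function (not necessarily monotone), and let $C>1$. The MSbM Algorithm (described in the context) run with $b_v=1$ for all $v$, parameter $C$ and $q=1/(2C+1)$ outputs a matching $M$ satisfying $$\frac{4C^2-1}{2C-2}\,\mathbb{E}[f(M)]\ge f(OPT),$$ where $OPT$ is a maximum-value matching. Taking $C=1+\frac{\sqrt3}{2}$ gives an approximation ratio of $4+2\sqrt3\approx7.464$. Moreover, if $f$ is monotone, the same algorithm satisfies $\left(2C+\frac{C}{C-1}\right)\mathbb{E}[f(M)]\ge f(OPT)$.
   Context: Edges arrive in a stream $e^{(1)},\dots,e^{(|E|)}$; write $e<e'$ if $e$ arrives before $e'$. Let $f_S(e)=f(S\cup\{e\})-f(S)$ and $f(e:S)=f_{S\cap\{e'<e\}}(e)$. MSbM Algorithm with parameters $C>0$, $q\in[0,1]$ (and degree bounds $b_v$): Initialize an empty stack $S$ and potentials $\phi_v^{(0)}=0$. For $t=1,\dots,|E|$: let $e=e^{(t)}$ and set $\phi^{(t)}_v=\phi^{(t-1)}_v$ for all $v$. If $C\sum_{v\in e}\phi^{(t-1)}_v\ge f(e:S)$, skip $e$. Otherwise, with probability $q$ (independent coin flip), push $e$ onto $S$ and for each $v\in e$ set $w_{ev}=\big(f(e:S)-\sum_{u\in e}\phi^{(t-1)}_u\big)/b_v$ and $\phi^{(t)}_v=\phi^{(t-1)}_v+w_{ev}$. Post-processing: set $M=\emptyset$; pop the edges of $S$ (last pushed first), adding a popped edge $e$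 to $M$ if every $v\in e$ has fewer than $b_v$ edges of $M$ incident to it. Output $M$. *)

theory Defs
  imports "HOL-Probability.Probability"
begin

definition simple_graph :: "'v set \<Rightarrow> 'v set set \<Rightarrow> bool" where
  "simple_graph V E \<longleftrightarrow> finite V \<and> (\<forall>e\<in>E. e \<subseteq> V \<and> card e = 2)"

definition matching :: "'v set set \<Rightarrow> 'v set set \<Rightarrow> bool" where
  "matching E M \<longleftrightarrow> M \<subseteq> E \<and> pairwise disjnt M"

definition max_value_matching :: "'v set set \<Rightarrow> ('v set set \<Rightarrow> real) \<Rightarrow> 'v set set \<Rightarrow> bool" where
  "max_value_matching E f M \<longleftrightarrow> matching E M \<and> (\<forall>M'. matching E M' \<longrightarrow> f M' \<le> f M)"

definition nonneg_on :: "'e set \<Rightarrow> ('e set \<Rightarrow> real) \<Rightarrow> bool" where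
  "nonneg_on E f \<longleftrightarrow> (\<forall>A\<subseteq>E. 0 \<le> f A)"

definition submodular_on :: "'e set \<Rightarrow> ('e set \<Rightarrow> real) \<Rightarrow> bool" where
  "submodular_on E f \<longleftrightarrow> (\<forall>A\<subseteq>E. \<forall>B\<subseteq>E. f (A \<union> B) + f (A \<inter> B) \<le> f A + f B)"

definition monotone_set_fun_on :: "'e set \<Rightarrow> ('e set \<Rightarrow> real) \<Rightarrow> bool" where
  "monotone_set_fun_on E f \<longleftrightarrow> (\<forall>A B. A \<subseteq> B \<longrightarrow> B \<subseteq> E \<longrightarrow> f A \<le> f B)"

definition stream_of :: "'e set \<Rightarrow> 'e list \<Rightarrow> bool" where
  "stream_of E es \<longleftrightarrow> distinct es \<and> set es = E"

definition arrives_before :: "'e list \<Rightarrow> 'e \<Rightarrow> 'e \<Rightarrow> bool" where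
  "arrives_before es e e' \<longleftrightarrow> (\<exists>i j. i < j \<and> j < length es \<and> es ! i = e \<and> es ! j = e')"

definition marginal :: "('e set \<Rightarrow> real) \<Rightarrow> 'e set \<Rightarrow> 'e \<Rightarrow> real" where
  "marginal f S e = f (S \<union> {e}) - f S"

text \<open>\<open>stream_marginal es f e S\<close> is $f(e:S)$ for the arrival order given by \<open>es\<close>.\<close>

definition stream_marginal :: "'e list \<Rightarrow> ('e set \<Rightarrow> real) \<Rightarrow> 'e \<Rightarrow> 'e set \<Rightarrow> real" where
  "stream_marginal es f e S = marginal f (S \<inter> {e'. arrives_before es e' e}) e"

text \<open>The state of the streaming phase is the stack, whose head is the edge pushed last,
  together with the vertex potentials.\<close>

type_synonym 'v msbm_state = "'v set list \<times> ('v \<Rightarrow> real)"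

definition msbm_push ::
  "'v set list \<Rightarrow> ('v set set \<Rightarrow> real) \<Rightarrow> ('v \<Rightarrow> nat) \<Rightarrow> 'v set \<Rightarrow> 'v msbm_state \<Rightarrow> 'v msbm_state" where
  "msbm_push es f b e = (\<lambda>(S, \<phi>).
     let w = (\<lambda>v. (stream_marginal es f e (set S) - (\<Sum>u\<in>e. \<phi> u)) / real (b v))
     in (e # S, \<lambda>v. if v \<in> e then \<phi> v + w v else \<phi> v))"

definition msbm_step ::
  "'v set list \<Rightarrow> ('v set set \<Rightarrow> real) \<Rightarrow> real \<Rightarrow> real \<Rightarrow> ('v \<Rightarrow> nat) \<Rightarrow>
    'v set \<Rightarrow> 'v msbm_state \<Rightarrow> 'v msbm_state pmf" where
  "msbm_step es f C q b e = (\<lambda>(S, \<phi>).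
     if C * (\<Sum>v\<in>e. \<phi> v) \<ge> stream_marginal es f e (set S) then return_pmf (S, \<phi>)
     else bind_pmf (bernoulli_pmf q)
       (\<lambda>coin. return_pmf (if coin then msbm_push es f b e (S, \<phi>) else (S, \<phi>))))"

text \<open>The first argument is the whole stream, which fixes the arrival order; the
  recursion is over the edges still to be processed.\<close>

primrec msbm_process ::
  "'v set list \<Rightarrow> ('v set set \<Rightarrow> real) \<Rightarrow> real \<Rightarrow> real \<Rightarrow> ('v \<Rightarrow> nat) \<Rightarrow>
    'v set list \<Rightarrow> 'v msbm_state \<Rightarrow> 'v msbm_state pmf" where
  "msbm_process es f C q b [] st = return_pmf st"
| "msbm_process es f C q b (e # rest) st =
     bind_pmf (msbm_step es f C q b e st) (msbm_process es f C q b rest)"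

primrec pop_stack :: "('v \<Rightarrow> nat) \<Rightarrow> 'v set list \<Rightarrow> 'v set set \<Rightarrow> 'v set set" where
  "pop_stack b [] M = M"
| "pop_stack b (e # S) M =
     pop_stack b S (if \<forall>v\<in>e. card {e'\<in>M. v \<in> e'} < b v then insert e M else M)"

definition msbm ::
  "'v set list \<Rightarrow> ('v set set \<Rightarrow> real) \<Rightarrow> real \<Rightarrow> real \<Rightarrow> ('v \<Rightarrow> nat) \<Rightarrow> 'v set set pmf" where
  "msbm es f C q b =
     map_pmf (\<lambda>(S, \<phi>). pop_stack b S {}) (msbm_process es f C q b es ([], \<lambda>_. 0))"

end

theory Submission
  imports Defs
begin

text \<open>
  Let \<open>W\<close> be half the total potential when the stream ends, so that \<open>W\<close> is the sum of
  \<open>f(e:S) - \<phi>(e)\<close> over the stack \<open>S\<close>. The acceptance test gives \<open>f S \<le> f {} + C/(C-1) W\<close>, and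
  unwinding the stack gives \<open>f M \<ge> f {} + W\<close>, because every stacked edge outside \<open>M\<close> meets a
  later edge of \<open>M\<close> whose value pays for it. For an edge \<open>e\<close> of \<open>OPT\<close> passing the test, the
  choice of \<open>q\<close> balances the loss from not sampling \<open>e\<close> against \<open>C\<close> times the potential
  created on \<open>e\<close> by sampling it; hence
  \<open>f (S \<union> P) - f S - C (\<Sum>v\<in>\<Union>P. \<phi> v)\<close>, where \<open>P\<close> is the part of \<open>OPT\<close> seen so far,
  is a supermartingale, and \<open>E (f (S \<union> OPT)) \<le> E (f S + 2 C W) \<le> (2 C + C/(C-1)) E (f M)\<close>.
  If \<open>f\<close> is monotone, \<open>f (S \<union> OPT) \<ge> f OPT\<close>. In general \<open>E (f (S \<union> OPT)) \<ge> (1 - q) f OPT\<close>,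
  since every edge enters \<open>S\<close> with conditional probability at most \<open>q\<close>.
\<close>

section \<open>Submodularity and the states of the streaming phase\<close>

lemma submodular_onD:
  assumes "submodular_on E f" "A \<subseteq> E" "B \<subseteq> E"
  shows "f (A \<union> B) + f (A \<inter> B) \<le> f A + f B"
  using assms unfolding submodular_on_def by blast

text \<open>The condition \<open>e \<notin> B\<close> matters: for \<open>e \<in> B\<close> the left
  side is 0, while the marginal over \<open>A\<close> may be negative because \<open>f\<close> need
  not be monotone.\<close>

lemma marginal_antimono:
  assumes "submodular_on E f" "A \<subseteq> B" "B \<subseteq> E" "e \<in> E" "e \<notin> B"
  shows "f (insert e B) - f B \<le> f (insert e A) - f A"
proof -
  have "insert e A \<union> B = insert e B" "insert e A \<inter> B = A"
    using assms by auto
  then show ?thesis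
    using submodular_onD[of E f "insert e A" B] assms by (simp add: subset_trans)
qed

text \<open>Every stacked edge has already arrived, so f(e:S) is the plain marginal over the stack;
  with unit capacities both endpoints rise by the same amount.\<close>

definition msbm_raise :: "('v set set \<Rightarrow> real) \<Rightarrow> 'v set list \<Rightarrow> ('v \<Rightarrow> real) \<Rightarrow> 'v set \<Rightarrow> 'v \<Rightarrow> real" where
  "msbm_raise f S \<phi> e =
     (\<lambda>v. if v \<in> e then \<phi> v + (f (insert e (set S)) - f (set S) - sum \<phi> e) else \<phi> v)"

text \<open>States stripped of coins and arrival order: any sequence of accepted pushes counts, so
  bounds that hold on every run become inductions over pushes.\<close>

inductive msbm_stack ::
  "'v set set \<Rightarrow> ('v set set \<Rightarrow> real) \<Rightarrow> real \<Rightarrow> 'v set list \<Rightarrow> ('v \<Rightarrow> real) \<Rightarrow> bool"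
  for E f C where
  Nil: "msbm_stack E f C [] (\<lambda>_. 0)"
| Push: "msbm_stack E f C S \<phi> \<Longrightarrow> e \<in> E \<Longrightarrow> e \<notin> set S \<Longrightarrow>
    C * sum \<phi> e < f (insert e (set S)) - f (set S) \<Longrightarrow>
    msbm_stack E f C (e # S) (msbm_raise f S \<phi> e)"

lemma msbm_stack_subset: "msbm_stack E f C S \<phi> \<Longrightarrow> set S \<subseteq> E"
  by (induction rule: msbm_stack.induct) auto

lemma sum_if_mem:
  fixes \<phi> :: "'v \<Rightarrow> real"
  assumes "finite A"
  shows "(\<Sum>v\<in>A. if v \<in> e then \<phi> v + w else \<phi> v) = sum \<phi> A + real (card (A \<inter> e)) * w"
proof -
  have "(\<Sum>v\<in>A. if v \<in> e then \<phi> v + w else \<phi> v) = (\<Sum>v\<in>A. \<phi> v + (if v \<in> e then w else 0))"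
    by (rule sum.cong) auto
  then show ?thesis
    using assms by (simp add: sum.distrib sum.If_cases)
qed

lemma free_iff:
  assumes "finite M"
  shows "(\<forall>v\<in>e. card {e'\<in>M. v \<in> e'} < (1::nat)) \<longleftrightarrow> e \<inter> \<Union>M = {}"
  using assms by (auto simp: card_eq_0_iff)

section \<open>Bounds on stack and output that hold on every run\<close>

locale msbm_instance =
  fixes V :: "'v set" and E :: "'v set set" and f :: "'v set set \<Rightarrow> real" and C :: real
  assumes graph: "simple_graph V E"
    and nonneg: "nonneg_on E f"
    and submod: "submodular_on E f"
    and C_gt_1: "C > 1"
begin

lemma finite_V: "finite V" and edge_subset: "e \<in> E \<Longrightarrow> e \<subseteq> V" and edge_card: "e \<in> E \<Longrightarrow> card e = 2"
  using graph by (auto simp: simple_graph_def)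

lemma finite_edge: "e \<in> E \<Longrightarrow> finite e"
  using edge_subset finite_V finite_subset by blast

lemma finite_E: "finite E"
  using finite_V edge_subset by (meson PowI finite_Pow_iff rev_finite_subset subsetI)

lemma f_nonneg: "A \<subseteq> E \<Longrightarrow> 0 \<le> f A"
  using nonneg by (simp add: nonneg_on_def)

lemma stack_pot_nonneg: "msbm_stack E f C S \<phi> \<Longrightarrow> 0 \<le> \<phi> v"
proof (induction arbitrary: v rule: msbm_stack.induct)
  case (Push S \<phi> e)
  have "0 \<le> sum \<phi> e"
    by (rule sum_nonneg) (use Push.IH in blast)
  then have "sum \<phi> e \<le> C * sum \<phi> e"
    using C_gt_1 mult_right_mono[of 1 C "sum \<phi> e"] by simp
  then show ?case
    using Push.hyps(4) Push.IH[of v] by (auto simp: msbm_raise_def)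
qed auto

lemma push_gain_pos:
  assumes "msbm_stack E f C S \<phi>" "C * sum \<phi> e < f (insert e (set S)) - f (set S)"
  shows "sum \<phi> e < f (insert e (set S)) - f (set S)"
proof -
  have "0 \<le> sum \<phi> e"
    by (rule sum_nonneg) (use stack_pot_nonneg[OF assms(1)] in blast)
  then have "sum \<phi> e \<le> C * sum \<phi> e"
    using C_gt_1 mult_right_mono[of 1 C "sum \<phi> e"] by simp
  then show ?thesis
    using assms(2) by simp
qed

lemma sum_raise:
  assumes "finite A"
  shows "sum (msbm_raise f S \<phi> e) A =
    sum \<phi> A + real (card (A \<inter> e)) * (f (insert e (set S)) - f (set S) - sum \<phi> e)"
  unfolding msbm_raise_def using assms by (rule sum_if_mem)

lemma sum_raise_V:
  assumes "e \<in> E"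
  shows "sum (msbm_raise f S \<phi> e) V =
    sum \<phi> V + 2 * (f (insert e (set S)) - f (set S) - sum \<phi> e)"
proof -
  have "V \<inter> e = e" using edge_subset[OF assms] by blast
  then show ?thesis
    using sum_raise[OF finite_V] edge_card[OF assms] by simp
qed

text \<open>The test \<open>C * sum \<phi> e < g\<close> rearranges to a bound of the marginal
  \<open>g\<close> by C/(C-1) times \<open>g - sum \<phi> e\<close>. A push raises two endpoints by
  that difference, so half the total potential grows by exactly it.\<close>

lemma stack_value_le:
  "msbm_stack E f C S \<phi> \<Longrightarrow> f (set S) \<le> f {} + C / (C - 1) * (sum \<phi> V / 2)"
proof (induction rule: msbm_stack.induct)
  case (Push S \<phi> e)
  define g where "g = f (insert e (set S)) - f (set S)"
  have "(C - 1) * g \<le> C * (g - sum \<phi> e)"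
    using Push.hyps(4) by (simp add: g_def algebra_simps)
  then have "g \<le> C / (C - 1) * (g - sum \<phi> e)"
    using C_gt_1 by (simp add: field_simps)
  moreover have "sum (msbm_raise f S \<phi> e) V / 2 = sum \<phi> V / 2 + (g - sum \<phi> e)"
    using sum_raise_V[OF Push.hyps(2), of S \<phi>] by (simp add: g_def)
  moreover have "f (set (e # S)) = f (set S) + g"
    by (simp add: g_def)
  ultimately show ?case
    using Push.IH by (simp only: distrib_left)
qed auto

lemma pop_stack_matching:
  assumes "set S \<subseteq> E" "matching E M"
  shows "matching E (pop_stack (\<lambda>_. 1) S M)"
  using assms
proof (induction S arbitrary: M)
  case (Cons e S)
  have "finite M"
    using Cons.prems finite_E finite_subset by (auto simp: matching_def)
  moreover have "matching E (insert e M)" if "e \<inter> \<Union>M = {}"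
    using Cons.prems that by (auto simp: matching_def pairwise_insert disjnt_def)
  ultimately show ?case
    using Cons free_iff[of M e] by simp
qed auto

text \<open>
  Unwinding the stack after the edges \<open>M\<close> have been chosen loses at most the potential of the
  vertices that \<open>M\<close> covers: a stacked edge blocked by \<open>M\<close> has raised the potential of one of them.
\<close>

lemma pop_stack_value_ge:
  assumes "msbm_stack E f C S \<phi>" "M \<subseteq> E" "M \<inter> set S = {}"
  shows "f (pop_stack (\<lambda>_. 1) S M)
    \<ge> f (M \<union> set S) - f (set S) + f {} + sum \<phi> V / 2 - sum \<phi> (\<Union>M)"
  using assms
proof (induction arbitrary: M rule: msbm_stack.induct)
  case (Push S \<phi> e)
  define w where "w = f (insert e (set S)) - f (set S) - sum \<phi> e"
  have finM: "finite M" and finUM: "finite (\<Union>M)"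
    using Push.prems finite_E finite_subset finite_edge by blast+
  have SE: "set S \<subseteq> E"
    using Push.hyps(1) msbm_stack_subset by blast
  have w_pos: "w > 0"
    using push_gain_pos[OF Push.hyps(1,4)] by (simp add: w_def)
  have sumV: "sum (msbm_raise f S \<phi> e) V = sum \<phi> V + 2 * w"
    using sum_raise_V[OF Push.hyps(2)] by (simp add: w_def)
  have sumM: "sum (msbm_raise f S \<phi> e) (\<Union>M) = sum \<phi> (\<Union>M) + real (card (\<Union>M \<inter> e)) * w"
    using sum_raise[OF finUM] by (simp add: w_def)
  show ?case
  proof (cases "e \<inter> \<Union>M = {}")
    case True
    \<comment> \<open>When \<open>e\<close> is taken, nothing is lost: the marginal of
      \<open>e\<close> minus \<open>w\<close> is the old potential of \<open>e\<close>, which is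
      what the newly covered endpoints subtract.\<close>
    have "f (pop_stack (\<lambda>_. 1) S (insert e M))
        \<ge> f (insert e M \<union> set S) - f (set S) + f {} + sum \<phi> V / 2 - sum \<phi> (\<Union>(insert e M))"
      using Push.hyps Push.prems by (intro Push.IH) auto
    moreover have "sum \<phi> (\<Union>(insert e M)) = sum \<phi> e + sum \<phi> (\<Union>M)"
      using True finUM finite_edge[OF Push.hyps(2)] by (simp add: sum.union_disjoint)
    moreover have "card (\<Union>M \<inter> e) = 0"
      using True by (simp add: Int_commute)
    ultimately show ?thesis
      using True free_iff[OF finM, of e] sumV sumM by (simp add: w_def add_divide_distrib diff_divide_distrib)
  next
    case False
    then have "card (\<Union>M \<inter> e) \<noteq> 0"
      using finUM by (auto simp: card_eq_0_iff)
    \<comment> \<open>At least one endpoint of the blocked edge is covered, so the subtracted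
      potential grows by at least \<open>w\<close>, cancelling the growth of half the total.\<close>
    then have "w \<le> real (card (\<Union>M \<inter> e)) * w"
      using w_pos mult_right_mono[of 1 "real (card (\<Union>M \<inter> e))" w] by simp
    moreover have "f (pop_stack (\<lambda>_. 1) S M)
        \<ge> f (M \<union> set S) - f (set S) + f {} + sum \<phi> V / 2 - sum \<phi> (\<Union>M)"
      using Push.prems by (intro Push.IH) auto
    \<comment> \<open>Equivalently, adding \<open>M\<close> gains no more over the stack with
      \<open>e\<close> than over the stack without it.\<close>
    moreover have "f (insert e (M \<union> set S)) - f (M \<union> set S) \<le> f (insert e (set S)) - f (set S)"
      using Push.hyps Push.prems SE by (intro marginal_antimono[OF submod]) auto
    moreover have "pop_stack (\<lambda>_. 1) (e # S) M = pop_stack (\<lambda>_. 1) S M"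
      using False free_iff[OF finM, of e] by auto
    ultimately show ?thesis
      using sumV sumM by (simp add: add_divide_distrib)
  qed
qed auto

text \<open>With \<open>W\<close> half the total potential, the left side is at most f {} + (2C + K)
  W and the output is worth at least f {} + W. The factor exceeds 1, so f {} \<ge> 0 is
  absorbed.\<close>

lemma output_value_ge:
  assumes "msbm_stack E f C S \<phi>"
  shows "f (set S) + C * sum \<phi> V \<le> (2 * C + C / (C - 1)) * f (pop_stack (\<lambda>_. 1) S {})"
proof -
  define W where "W = sum \<phi> V / 2"
  define K where "K = C / (C - 1)"
  have K: "K \<ge> 1"
    using C_gt_1 by (simp add: K_def field_simps)
  have f0: "0 \<le> f {}"
    using f_nonneg by simp
  have "f {} \<le> (2 * C + K) * f {}"
    using mult_right_mono[of 1 "2 * C + K" "f {}"] f0 K C_gt_1 by simp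
  moreover have "f (set S) + C * sum \<phi> V \<le> f {} + (2 * C + K) * W"
    using stack_value_le[OF assms] by (simp add: W_def K_def algebra_simps)
  moreover have "(2 * C + K) * (f {} + W) \<le> (2 * C + K) * f (pop_stack (\<lambda>_. 1) S {})"
    using pop_stack_value_ge[OF assms, of "{}"] K C_gt_1
    by (intro mult_left_mono) (simp_all add: W_def)
  ultimately show ?thesis
    unfolding K_def[symmetric] by (simp add: distrib_left)
qed

end

section \<open>Unfolding one step of the random process\<close>

lemma stream_marginal_eq:
  assumes "distinct (pre @ e # rest)" "set S \<subseteq> set pre"
  shows "stream_marginal (pre @ e # rest) f e (set S) = f (insert e (set S)) - f (set S)"
proof -
  have "arrives_before (pre @ e # rest) x e" if x: "x \<in> set S" for x
  proof -
    obtain i where "i < length pre" "pre ! i = x"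
      using x assms(2) by (meson in_set_conv_nth subsetD)
    then show ?thesis
      unfolding arrives_before_def
      by (intro exI[of _ i] exI[of _ "length pre"]) (auto simp: nth_append)
  qed
  then have "set S \<inter> {e'. arrives_before (pre @ e # rest) e' e} = set S"
    by blast
  then show ?thesis
    by (simp add: stream_marginal_def marginal_def)
qed

lemma msbm_step_eq:
  assumes "es = pre @ e # rest" "distinct es" "set S \<subseteq> set pre"
  shows "msbm_step es f C q (\<lambda>_. 1) e (S, \<phi>) =
    (if f (insert e (set S)) - f (set S) \<le> C * sum \<phi> e then return_pmf (S, \<phi>)
     else map_pmf (\<lambda>coin. if coin then (e # S, msbm_raise f S \<phi> e) else (S, \<phi>)) (bernoulli_pmf q))"
  using stream_marginal_eq[of pre e rest S f] assms
  by (simp add: msbm_step_def msbm_push_def msbm_raise_def map_pmf_def Let_def cong: if_cong)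

lemma finite_set_msbm_process: "finite (set_pmf (msbm_process es f C q b rest st))"
  by (induction rest arbitrary: st) (auto simp: msbm_step_def split: prod.splits)

text \<open>The one-edge recursion behind both expectation inductions; finite support turns the
  expectation over the coin into a two-term sum.\<close>

lemma expectation_msbm_process_Cons:
  fixes h :: "'v msbm_state \<Rightarrow> real"
  assumes "es = pre @ e # rest" "distinct es" "set S \<subseteq> set pre" "0 \<le> q" "q \<le> 1"
  shows "measure_pmf.expectation (msbm_process es f C q (\<lambda>_. 1) (e # rest) (S, \<phi>)) h =
    (if f (insert e (set S)) - f (set S) \<le> C * sum \<phi> e
     then measure_pmf.expectation (msbm_process es f C q (\<lambda>_. 1) rest (S, \<phi>)) h
     else q * measure_pmf.expectation
            (msbm_process es f C q (\<lambda>_. 1) rest (e # S, msbm_raise f S \<phi> e)) h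
        + (1 - q) * measure_pmf.expectation (msbm_process es f C q (\<lambda>_. 1) rest (S, \<phi>)) h)"
proof (cases "f (insert e (set S)) - f (set S) \<le> C * sum \<phi> e")
  case True
  then show ?thesis
    using msbm_step_eq[OF assms(1-3), of f C q \<phi>] by (simp add: bind_return_pmf)
next
  case False
  have "measure_pmf.expectation (bernoulli_pmf q \<bind>
      (\<lambda>coin. msbm_process es f C q (\<lambda>_. 1) rest
         (if coin then (e # S, msbm_raise f S \<phi> e) else (S, \<phi>)))) h =
    (\<Sum>coin\<in>UNIV. pmf (bernoulli_pmf q) coin *\<^sub>R measure_pmf.expectation
      (msbm_process es f C q (\<lambda>_. 1) rest (if coin then (e # S, msbm_raise f S \<phi> e) else (S, \<phi>))) h)"
    by (rule pmf_expectation_bind) (auto simp: finite_set_msbm_process)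
  then show ?thesis
    using False msbm_step_eq[OF assms(1-3), of f C q \<phi>] assms(4,5)
    by (simp add: bind_map_pmf UNIV_bool)
qed

section \<open>Expected values along the stream\<close>

context msbm_instance
begin

text \<open>Transfers the bounds on \<open>msbm_stack\<close> to every outcome of the process.
  Keeping the stack inside the processed prefix shows that an arriving edge is not yet
  stacked.\<close>

lemma msbm_process_stack:
  assumes "distinct es" "set es = E" "es = pre @ rest" "set S \<subseteq> set pre" "msbm_stack E f C S \<phi>"
    and "(S', \<phi>') \<in> set_pmf (msbm_process es f C q (\<lambda>_. 1) rest (S, \<phi>))"
  shows "msbm_stack E f C S' \<phi>'"
  using assms(3-)
proof (induction rest arbitrary: pre S \<phi>)
  case (Cons e rest)
  have e: "e \<in> E" "e \<notin> set S"
    using Cons.prems assms(1,2) by auto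
  obtain S1 \<phi>1 where 1: "(S1, \<phi>1) \<in> set_pmf (msbm_step es f C q (\<lambda>_. 1) e (S, \<phi>))"
    and 2: "(S', \<phi>') \<in> set_pmf (msbm_process es f C q (\<lambda>_. 1) rest (S1, \<phi>1))"
    using Cons.prems by auto
  have "(S1, \<phi>1) = (S, \<phi>) \<or>
      (S1, \<phi>1) = (e # S, msbm_raise f S \<phi> e) \<and> C * sum \<phi> e < f (insert e (set S)) - f (set S)"
    using 1 unfolding msbm_step_eq[OF Cons.prems(1) assms(1) Cons.prems(2)]
    by (auto split: if_splits)
  then have "msbm_stack E f C S1 \<phi>1" "set S1 \<subseteq> set (pre @ [e])"
    using Cons.prems e by (auto intro: msbm_stack.Push)
  then show ?case
    using Cons.IH[of "pre @ [e]" S1 \<phi>1] Cons.prems 2 by auto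
qed auto

lemma stack_value_supermartingale:
  assumes "distinct es" "set es = E" "matching E OPT" "q = 1 / (2 * C + 1)"
    and "es = pre @ rest" "set S \<subseteq> set pre" "msbm_stack E f C S \<phi>"
  shows "measure_pmf.expectation (msbm_process es f C q (\<lambda>_. 1) rest (S, \<phi>))
      (\<lambda>(S, \<phi>). f (set S \<union> OPT) - f (set S) - C * sum \<phi> (\<Union>OPT))
    \<le> f (set S \<union> (OPT \<inter> set pre)) - f (set S) - C * sum \<phi> (\<Union>(OPT \<inter> set pre))"
  using assms(5-)
proof (induction rest arbitrary: pre S \<phi>)
  case Nil
  have "OPT \<inter> set pre = OPT"
    using Nil assms by (auto simp: matching_def)
  then show ?case by simp
next
  case (Cons e rest)
  \<comment> \<open>The identity \<open>2 * q * C = 1 - q\<close> is what determines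
    \<open>q\<close>; it cancels the marginal \<open>g\<close> between the two coin
    outcomes.\<close>
  have q: "0 \<le> q" "q \<le> 1" "2 * q \<le> 1" "2 * q * C = 1 - q"
    using C_gt_1 unfolding assms(4) by (simp_all add: divide_simps)
  define O1 where "O1 = OPT \<inter> set pre"
  define O2 where "O2 = OPT \<inter> set (pre @ [e])"
  define g where "g = f (insert e (set S)) - f (set S)"
  define \<Phi> where "\<Phi> = (\<lambda>S \<phi> P. f (set S \<union> P) - f (set S) - C * sum \<phi> (\<Union>P))"
  let ?X = "\<lambda>st. measure_pmf.expectation (msbm_process es f C q (\<lambda>_. 1) rest st)
      (\<lambda>(S, \<phi>). f (set S \<union> OPT) - f (set S) - C * sum \<phi> (\<Union>OPT))"
  have e: "e \<in> E" "e \<notin> set S" "e \<notin> set pre"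
    using Cons.prems assms(1,2) by auto
  have preE: "set pre \<subseteq> E" and SE: "set S \<subseteq> E"
    using Cons.prems assms(2) by auto
  have O1: "e \<notin> O1" "O1 \<subseteq> E"
    using e preE by (auto simp: O1_def)
  have finU: "finite (\<Union>O1)"
    using O1(2) finite_E finite_edge by (meson finite_Union finite_subset subsetD)
  have O2: "O2 = (if e \<in> OPT then insert e O1 else O1)"
    by (auto simp: O1_def O2_def)
  have skip: "?X (S, \<phi>) \<le> \<Phi> S \<phi> O2"
    using Cons.IH[of "pre @ [e]" S \<phi>] Cons.prems by (auto simp: \<Phi>_def O2_def)
  have push: "?X (e # S, msbm_raise f S \<phi> e) \<le> \<Phi> (e # S) (msbm_raise f S \<phi> e) O2"
    if "C * sum \<phi> e < g"
    using Cons.IH[of "pre @ [e]" "e # S" "msbm_raise f S \<phi> e"] Cons.prems e that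
    by (auto simp: \<Phi>_def O2_def g_def intro: msbm_stack.Push)
  have sub: "f (insert e (set S \<union> O1)) - f (set S \<union> O1) \<le> g"
    unfolding g_def using SE O1 e by (intro marginal_antimono[OF submod]) auto
  \<comment> \<open>Edges of a matching share no vertex, so no potential is counted twice.\<close>
  have sum_insert: "sum \<psi> (\<Union>(insert e O1)) = sum \<psi> e + sum \<psi> (\<Union>O1)"
    if "e \<in> OPT" for \<psi> :: "'v \<Rightarrow> real"
  proof -
    have "e \<inter> x = {}" if "x \<in> O1" for x
    proof -
      have "x \<in> OPT" "x \<noteq> e"
        using that O1(1) by (auto simp: O1_def)
      then show ?thesis
        using assms(3) \<open>e \<in> OPT\<close> unfolding matching_def pairwise_def disjnt_def by blast
    qed
    then show ?thesis
      using finU finite_edge[OF e(1)] by (simp add: sum.union_disjoint Int_Union)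
  qed
  have skip_le: "\<Phi> S \<phi> O2 \<le> \<Phi> S \<phi> O1 + (if e \<in> OPT then g - C * sum \<phi> e else 0)"
    using sub sum_insert[of \<phi>] by (simp add: \<Phi>_def O2 distrib_left)
  \<comment> \<open>Pushing \<open>e\<close> puts it into both sets, so submodularity keeps the
    difference of values from growing. If \<open>e\<close> is in \<open>OPT\<close>, its two raised
    endpoints are charged as well.\<close>
  have push_le: "\<Phi> (e # S) (msbm_raise f S \<phi> e) O2
      \<le> \<Phi> S \<phi> O1 - (if e \<in> OPT then C * (sum \<phi> e + 2 * (g - sum \<phi> e)) else 0)"
    if g: "C * sum \<phi> e < g"
  proof -
    have w: "0 \<le> g - sum \<phi> e"
      using push_gain_pos[OF Cons.prems(3)] g by (simp add: g_def less_imp_le)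
    have "sum \<phi> (\<Union>O1) \<le> sum (msbm_raise f S \<phi> e) (\<Union>O1)"
      using sum_raise[OF finU, of S \<phi> e] w by (simp add: g_def)
    then have mono: "C * sum \<phi> (\<Union>O1) \<le> C * sum (msbm_raise f S \<phi> e) (\<Union>O1)"
      using C_gt_1 by (intro mult_left_mono) auto
    have "sum (msbm_raise f S \<phi> e) e = sum \<phi> e + 2 * (g - sum \<phi> e)"
      using sum_raise[OF finite_edge[OF e(1)], of S \<phi> e] edge_card[OF e(1)] by (simp add: g_def)
    then show ?thesis
      using mono sub sum_insert[of "msbm_raise f S \<phi> e"]
      by (simp add: \<Phi>_def O2 distrib_left g_def)
  qed
  have \<phi>e: "0 \<le> sum \<phi> e"
    by (rule sum_nonneg) (use stack_pot_nonneg[OF Cons.prems(3)] in blast)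
  have "measure_pmf.expectation (msbm_process es f C q (\<lambda>_. 1) (e # rest) (S, \<phi>))
      (\<lambda>(S, \<phi>). f (set S \<union> OPT) - f (set S) - C * sum \<phi> (\<Union>OPT)) \<le> \<Phi> S \<phi> O1"
  proof (cases "g \<le> C * sum \<phi> e")
    case True
    then have "\<Phi> S \<phi> O2 \<le> \<Phi> S \<phi> O1"
      using skip_le by (auto split: if_splits)
    then show ?thesis
      using True skip unfolding expectation_msbm_process_Cons[OF Cons.prems(1) assms(1) Cons.prems(2) q(1,2)]
      by (simp add: g_def)
  next
    case False
    let ?d = "\<lambda>x. if e \<in> OPT then x else (0::real)"
    have "q * ?X (e # S, msbm_raise f S \<phi> e) + (1 - q) * ?X (S, \<phi>)
      \<le> q * (\<Phi> S \<phi> O1 - ?d (C * (sum \<phi> e + 2 * (g - sum \<phi> e))))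
        + (1 - q) * (\<Phi> S \<phi> O1 + ?d (g - C * sum \<phi> e))"
      using False skip push skip_le push_le q by (intro add_mono mult_left_mono) auto
    \<comment> \<open>The coefficient of \<open>g\<close> is zero by the choice of \<open>q\<close>;
      the remaining term has the right sign since \<open>2 * q \<le> 1\<close>.\<close>
    also have "\<dots> = \<Phi> S \<phi> O1 + ?d ((1 - q - 2 * q * C) * g - (1 - 2 * q) * (C * sum \<phi> e))"
      by (simp add: algebra_simps)
    also have "\<dots> \<le> \<Phi> S \<phi> O1"
      using q \<phi>e C_gt_1 by simp
    finally show ?thesis
      using False unfolding expectation_msbm_process_Cons[OF Cons.prems(1) assms(1) Cons.prems(2) q(1,2)]
      by (simp add: g_def)
  qed
  then show ?case
    by (simp add: \<Phi>_def O1_def)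
qed

text \<open>
  The bound \<open>(1 - q) f (S \<union> OPT)\<close> alone is lost geometrically along the stream; the minimum
  on the right-hand side is what makes the induction close.
\<close>

lemma expectation_union_ge_Min:
  assumes "distinct es" "set es = E" "OPT \<subseteq> E" "0 \<le> q" "q \<le> 1"
    and "es = pre @ rest" "set S \<subseteq> set pre"
  shows "(1 - q) * f (set S \<union> OPT) + q * Min ((\<lambda>T. f (set S \<union> OPT \<union> T)) ` Pow (set rest))
    \<le> measure_pmf.expectation (msbm_process es f C q (\<lambda>_. 1) rest (S, \<phi>))
        (\<lambda>(S, \<phi>). f (set S \<union> OPT))"
  using assms(6-)
proof (induction rest arbitrary: pre S \<phi>)
  case Nil
  then show ?case by (simp add: algebra_simps)
next
  case (Cons e rest)
  \<comment> \<open>The worst value reachable by adding edges that are still to come.\<close>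
  define m where "m = (\<lambda>A R. Min ((\<lambda>T. f (A \<union> OPT \<union> T)) ` Pow (set R)))"
  let ?X = "\<lambda>st. measure_pmf.expectation (msbm_process es f C q (\<lambda>_. 1) rest st)
      (\<lambda>(S, \<phi>). f (set S \<union> OPT))"
  define M where "M = m (set S) (e # rest)"
  have M_le: "M \<le> f (set S \<union> OPT \<union> T)" if "T \<subseteq> set (e # rest)" for T
    unfolding M_def m_def by (rule Min_le) (use that in auto)
  have m_attained: "\<exists>T\<subseteq>set rest. m A rest = f (A \<union> OPT \<union> T)" for A
  proof -
    have "m A rest \<in> (\<lambda>T. f (A \<union> OPT \<union> T)) ` Pow (set rest)"
      unfolding m_def by (rule Min_in) auto
    then show ?thesis by auto
  qed
  obtain T where T: "T \<subseteq> set rest" "m (set S) rest = f (set S \<union> OPT \<union> T)"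
    using m_attained by blast
  obtain U where U: "U \<subseteq> set rest" "m (insert e (set S)) rest = f (insert e (set S) \<union> OPT \<union> U)"
    using m_attained by blast
  have skip: "(1 - q) * f (set S \<union> OPT) + q * m (set S) rest \<le> ?X (S, \<phi>)"
    using Cons.IH[of "pre @ [e]" S \<phi>] Cons.prems by (auto simp: m_def)
  have push: "(1 - q) * f (insert e (set S) \<union> OPT) + q * m (insert e (set S)) rest \<le> ?X (e # S, \<psi>)"
    for \<psi>
    using Cons.IH[of "pre @ [e]" "e # S" \<psi>] Cons.prems by (auto simp: m_def)
  have m_ge: "M \<le> m (set S) rest"
    using M_le[of T] T by auto
  have m_push_ge: "M \<le> m (insert e (set S)) rest"
    using M_le[of "insert e U"] U by auto
  \<comment> \<open>With \<open>T\<close> attaining the minimum after a skip, submodularity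
    exchanges \<open>e\<close> between \<open>T\<close> and the current union; the set with both
    \<open>T\<close> and \<open>e\<close> is a candidate for \<open>M\<close>.\<close>
  have union_ge: "f (set S \<union> OPT) + M \<le> f (insert e (set S) \<union> OPT) + m (set S) rest"
  proof (cases "e \<in> OPT")
    case True
    then have "insert e (set S) \<union> OPT = set S \<union> OPT" by auto
    then show ?thesis using m_ge by simp
  next
    case False
    have "f (insert e (set S \<union> OPT \<union> T)) - f (set S \<union> OPT \<union> T)
        \<le> f (insert e (set S \<union> OPT)) - f (set S \<union> OPT)"
      using Cons.prems assms(1-3) T(1) False
      by (intro marginal_antimono[OF submod]) auto
    moreover have "M \<le> f (insert e (set S \<union> OPT \<union> T))"
      using M_le[of "insert e T"] T(1) by auto
    ultimately show ?thesis
      using T(2) by simp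
  qed
  have "(1 - q) * f (set S \<union> OPT) + q * M
    \<le> measure_pmf.expectation (msbm_process es f C q (\<lambda>_. 1) (e # rest) (S, \<phi>))
        (\<lambda>(S, \<phi>). f (set S \<union> OPT))"
  proof (cases "f (insert e (set S)) - f (set S) \<le> C * sum \<phi> e")
    case True
    have "q * M \<le> q * m (set S) rest"
      using m_ge assms(4) by (rule mult_left_mono)
    then show ?thesis
      using True skip
      unfolding expectation_msbm_process_Cons[OF Cons.prems(1) assms(1) Cons.prems(2) assms(4,5)]
      by simp
  next
    case False
    \<comment> \<open>The weights are split by two independent \<open>q\<close>-coins, so that the
      mixed term matches \<open>union_ge\<close> and the \<open>q * q\<close> term matches
      \<open>m_push_ge\<close>.\<close>
    have "(1 - q) * f (set S \<union> OPT) + q * M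
        = (1 - q) * (1 - q) * f (set S \<union> OPT) + q * (1 - q) * (f (set S \<union> OPT) + M) + q * q * M"
      by (simp add: algebra_simps)
    also have "\<dots> \<le> (1 - q) * (1 - q) * f (set S \<union> OPT)
        + q * (1 - q) * (f (insert e (set S) \<union> OPT) + m (set S) rest)
        + q * q * m (insert e (set S)) rest"
      using mult_left_mono[OF union_ge, of "q * (1 - q)"] mult_left_mono[OF m_push_ge, of "q * q"]
        assms(4,5) by simp
    also have "\<dots> = q * ((1 - q) * f (insert e (set S) \<union> OPT) + q * m (insert e (set S)) rest)
        + (1 - q) * ((1 - q) * f (set S \<union> OPT) + q * m (set S) rest)"
      by (simp add: algebra_simps)
    also have "\<dots> \<le> q * ?X (e # S, msbm_raise f S \<phi> e) + (1 - q) * ?X (S, \<phi>)"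
      using skip push assms(4,5) by (intro add_mono mult_left_mono) auto
    finally show ?thesis
      using False
      unfolding expectation_msbm_process_Cons[OF Cons.prems(1) assms(1) Cons.prems(2) assms(4,5)]
      by simp
  qed
  then show ?case
    by (simp add: M_def m_def)
qed

section \<open>The output matching and its approximation ratios\<close>

lemma msbm_matching:
  assumes "stream_of E es" "M \<in> set_pmf (msbm es f C q (\<lambda>_. 1))"
  shows "matching E M"
proof -
  obtain S \<phi> where M: "M = pop_stack (\<lambda>_. 1) S {}"
    and "(S, \<phi>) \<in> set_pmf (msbm_process es f C q (\<lambda>_. 1) es ([], \<lambda>_. 0))"
    using assms(2) by (auto simp: msbm_def)
  then have "msbm_stack E f C S \<phi>"
    using msbm_process_stack[of es "[]" es "[]" "\<lambda>_. 0" S \<phi> q] assms(1)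
    by (auto simp: stream_of_def intro: msbm_stack.Nil)
  then show ?thesis
    unfolding M by (intro pop_stack_matching msbm_stack_subset) (auto simp: matching_def)
qed

text \<open>On every run f(S \<union> OPT) is the supermartingale value plus f(S) plus
  \<open>C\<close> times the potential on \<open>OPT\<close>. The last two are paid for by the
  output, since \<open>OPT\<close> covers at most all of \<open>V\<close>.\<close>

lemma expectation_union_le:
  assumes "stream_of E es" "matching E OPT" "q = 1 / (2 * C + 1)"
  shows "measure_pmf.expectation (msbm_process es f C q (\<lambda>_. 1) es ([], \<lambda>_. 0))
      (\<lambda>(S, \<phi>). f (set S \<union> OPT))
    \<le> (2 * C + C / (C - 1)) * measure_pmf.expectation (msbm es f C q (\<lambda>_. 1)) f"
proof -
  define p where "p = msbm_process es f C q (\<lambda>_. 1) es ([], \<lambda>_. 0)"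
  define K where "K = 2 * C + C / (C - 1)"
  have int: "integrable (measure_pmf p) h" for h :: "_ \<Rightarrow> real"
    unfolding p_def by (intro integrable_measure_pmf_finite finite_set_msbm_process)
  have stream: "distinct es" "set es = E"
    using assms(1) by (auto simp: stream_of_def)
  have UV: "\<Union>OPT \<subseteq> V"
    using assms(2) edge_subset by (auto simp: matching_def)
  have pointwise: "(case x of (S, \<phi>) \<Rightarrow> f (set S \<union> OPT)) \<le>
      (case x of (S, \<phi>) \<Rightarrow> f (set S \<union> OPT) - f (set S) - C * sum \<phi> (\<Union>OPT))
      + K * (case x of (S, \<phi>) \<Rightarrow> f (pop_stack (\<lambda>_. 1) S {}))" if x_in: "x \<in> set_pmf p" for x
  proof -
    obtain S \<phi> where x: "x = (S, \<phi>)" by fastforce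
    have st: "msbm_stack E f C S \<phi>"
      using msbm_process_stack[of es "[]" es "[]" "\<lambda>_. 0" S \<phi> q] stream x_in
      by (auto simp: p_def x intro: msbm_stack.Nil)
    have "sum \<phi> (\<Union>OPT) \<le> sum \<phi> V"
      using finite_V UV stack_pot_nonneg[OF st] by (intro sum_mono2) auto
    then have "C * sum \<phi> (\<Union>OPT) \<le> C * sum \<phi> V"
      using C_gt_1 by (intro mult_left_mono) auto
    then show ?thesis
      using output_value_ge[OF st] by (simp add: x K_def)
  qed
  have "measure_pmf.expectation p (\<lambda>(S, \<phi>). f (set S \<union> OPT))
    \<le> measure_pmf.expectation p (\<lambda>x.
      (case x of (S, \<phi>) \<Rightarrow> f (set S \<union> OPT) - f (set S) - C * sum \<phi> (\<Union>OPT))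
      + K * (case x of (S, \<phi>) \<Rightarrow> f (pop_stack (\<lambda>_. 1) S {})))"
    using pointwise by (intro integral_mono_AE int) (auto simp: AE_measure_pmf_iff)
  also have "\<dots> = measure_pmf.expectation p
        (\<lambda>(S, \<phi>). f (set S \<union> OPT) - f (set S) - C * sum \<phi> (\<Union>OPT))
      + K * measure_pmf.expectation p (\<lambda>(S, \<phi>). f (pop_stack (\<lambda>_. 1) S {}))"
    by (subst Bochner_Integration.integral_add[OF int int]) simp
  \<comment> \<open>The supermartingale starts at 0: the stack and the seen part of
    \<open>OPT\<close> are both empty.\<close>
  also have "measure_pmf.expectation p
        (\<lambda>(S, \<phi>). f (set S \<union> OPT) - f (set S) - C * sum \<phi> (\<Union>OPT)) \<le> 0"
    using stack_value_supermartingale[OF stream assms(2,3), of "[]" es "[]" "\<lambda>_. 0"]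
    by (simp add: p_def msbm_stack.Nil)
  also have "measure_pmf.expectation p (\<lambda>(S, \<phi>). f (pop_stack (\<lambda>_. 1) S {}))
      = measure_pmf.expectation (msbm es f C q (\<lambda>_. 1)) f"
    by (simp add: msbm_def p_def case_prod_unfold)
  finally show ?thesis
    by (simp add: p_def K_def)
qed

lemma msbm_approx_monotone:
  assumes "stream_of E es" "matching E OPT" "q = 1 / (2 * C + 1)" "monotone_set_fun_on E f"
  shows "f OPT \<le> (2 * C + C / (C - 1)) * measure_pmf.expectation (msbm es f C q (\<lambda>_. 1)) f"
proof -
  define p where "p = msbm_process es f C q (\<lambda>_. 1) es ([], \<lambda>_. 0)"
  have int: "integrable (measure_pmf p) h" for h :: "_ \<Rightarrow> real"
    unfolding p_def by (intro integrable_measure_pmf_finite finite_set_msbm_process)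
  have "f OPT \<le> f (set S \<union> OPT)" if "(S, \<phi>) \<in> set_pmf p" for S \<phi>
  proof -
    have "msbm_stack E f C S \<phi>"
      using msbm_process_stack[of es "[]" es "[]" "\<lambda>_. 0" S \<phi> q] assms(1) that
      by (auto simp: p_def stream_of_def intro: msbm_stack.Nil)
    then show ?thesis
      using msbm_stack_subset[of E f C S \<phi>] assms(2,4)
      by (simp add: monotone_set_fun_on_def matching_def)
  qed
  then have "measure_pmf.expectation p (\<lambda>_. f OPT)
      \<le> measure_pmf.expectation p (\<lambda>(S, \<phi>). f (set S \<union> OPT))"
    by (intro integral_mono_AE int) (auto simp: AE_measure_pmf_iff)
  then show ?thesis
    using expectation_union_le[OF assms(1-3)] by (simp add: p_def)
qed

lemma msbm_approx:
  assumes "stream_of E es" "matching E OPT" "q = 1 / (2 * C + 1)"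
  shows "f OPT \<le> (4 * C\<^sup>2 - 1) / (2 * C - 2) * measure_pmf.expectation (msbm es f C q (\<lambda>_. 1)) f"
proof -
  define X where "X = measure_pmf.expectation (msbm es f C q (\<lambda>_. 1)) f"
  have q: "0 \<le> q" "q \<le> 1"
    using C_gt_1 assms(3) by auto
  have OPT: "OPT \<subseteq> E"
    using assms(2) by (simp add: matching_def)
  have stream: "distinct es" "set es = E"
    using assms(1) by (auto simp: stream_of_def)
  \<comment> \<open>Nonnegativity of \<open>f\<close> allows the minimum to be discarded.\<close>
  have "0 \<le> Min ((\<lambda>T. f (OPT \<union> T)) ` Pow (set es))"
    using OPT stream by (subst Min_ge_iff) (auto intro!: f_nonneg)
  then have "(1 - q) * f OPT \<le>
      (1 - q) * f OPT + q * Min ((\<lambda>T. f (OPT \<union> T)) ` Pow (set es))"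
    using q by simp
  also have "\<dots> \<le> (2 * C + C / (C - 1)) * X"
    using expectation_union_ge_Min[OF stream OPT q, of "[]" es "[]" "\<lambda>_. 0"]
      expectation_union_le[OF assms] by (simp add: X_def)
  also have "1 - q = 2 * C / (2 * C + 1)"
    using C_gt_1 assms(3) by (simp add: field_simps)
  finally have "f OPT \<le> (2 * C + 1) / (2 * C) * ((2 * C + C / (C - 1)) * X)"
    using C_gt_1 by (simp add: field_simps)
  \<comment> \<open>Here 2C + C/(C-1) = C(2C-1)/(C-1), and (2C+1)(2C-1) gives the numerator.\<close>
  also have "\<dots> = (4 * C\<^sup>2 - 1) / (2 * C - 2) * X"
    using C_gt_1 by (simp add: divide_simps) (simp add: algebra_simps power2_eq_square)
  finally show ?thesis
    by (simp add: X_def)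
qed

end

lemma sqrt3_ratio:
  assumes "C0 = 1 + sqrt 3 / 2"
  shows "(4 * C0\<^sup>2 - 1) / (2 * C0 - 2) = 4 + 2 * sqrt 3"
proof -
  have "2 * C0 - 2 = sqrt 3" "4 * C0\<^sup>2 - 1 = sqrt 3 * (4 + 2 * sqrt 3)"
    by (simp_all add: assms power2_eq_square algebra_simps)
  then show ?thesis by simp
qed

text \<open>The tolerance is half a unit in the third decimal, so 7.464 is the correctly rounded
  value.\<close>

lemma sqrt3_approx: "\<bar>4 + 2 * sqrt 3 - 7.464\<bar> < (0.0005::real)"
proof -
  have "1.73202 < sqrt 3" "sqrt 3 < (1.73206::real)"
    by (rule real_less_rsqrt real_less_lsqrt; simp add: power2_eq_square)+
  then show ?thesis by (simp add: abs_if)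
qed

theorem theorem5p1:
  fixes V :: "'v set" and E OPT :: "'v set set" and es :: "'v set list"
    and f :: "'v set set \<Rightarrow> real" and C :: real
  assumes "simple_graph V E"
    and "stream_of E es"
    and "nonneg_on E f"
    and "submodular_on E f"
    and "max_value_matching E f OPT"
    and "C > 1"
  shows "(\<forall>M \<in> set_pmf (msbm es f C (1 / (2 * C + 1)) (\<lambda>_. 1)). matching E M)
    \<and> (4 * C\<^sup>2 - 1) / (2 * C - 2)
        * measure_pmf.expectation (msbm es f C (1 / (2 * C + 1)) (\<lambda>_. 1)) f \<ge> f OPT
    \<and> (let C0 = 1 + sqrt 3 / 2 in
         (4 * C0\<^sup>2 - 1) / (2 * C0 - 2) = 4 + 2 * sqrt 3
         \<and> \<bar>4 + 2 * sqrt 3 - 7.464\<bar> < 0.0005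
         \<and> (4 + 2 * sqrt 3)
             * measure_pmf.expectation (msbm es f C0 (1 / (2 * C0 + 1)) (\<lambda>_. 1)) f \<ge> f OPT)
    \<and> (monotone_set_fun_on E f \<longrightarrow>
         (2 * C + C / (C - 1))
           * measure_pmf.expectation (msbm es f C (1 / (2 * C + 1)) (\<lambda>_. 1)) f \<ge> f OPT)"
proof -
  interpret msbm_instance V E f C
    using assms by unfold_locales
  define C0 where "C0 = 1 + sqrt 3 / 2"
  \<comment> \<open>The claim about \<open>C0\<close> concerns a run with its own parameter,
    independent of \<open>C\<close>, hence a second instance.\<close>
  have C0: "msbm_instance V E f C0"
    using assms by unfold_locales (auto simp: C0_def)
  have OPT: "matching E OPT"
    using assms(5) by (simp add: max_value_matching_def)
  have "f OPT \<le> (4 + 2 * sqrt 3)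
      * measure_pmf.expectation (msbm es f C0 (1 / (2 * C0 + 1)) (\<lambda>_. 1)) f"
    using msbm_instance.msbm_approx[OF C0 assms(2) OPT refl] sqrt3_ratio[OF C0_def] by simp
  then show ?thesis
    using msbm_matching[OF assms(2)] msbm_approx[OF assms(2) OPT refl]
      msbm_approx_monotone[OF assms(2) OPT refl] sqrt3_ratio[OF C0_def] sqrt3_approx
    unfolding Let_def C0_def[symmetric] by blast
qed

end
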